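(* Let $G$ be a graph. Then $\mathsf{tree}\text{-}\alpha(G)\le 1$ if and only if $G$ is chordal.
   Context: All graphs are finite, simple, and undirected. A graph is chordal if it has no induced cycles of length at least four. A tree decomposition of a graph $G$ is a pair $\mathcal{T}=(T,\{X_t\}_{t\in V(T)})$ where $T$ is a tree and each node $t$ is assigned a bag $X_t\subseteq V(G)$ such that every vertex of $G$ is in at least one bag, every edge of $G$ has both endpoints in some common bag, and for every $u\in V(G)$ the subgraph of $T$ induced by $\{t: u\in X_t\}$ is connected. The independence number of $\mathcal{T}$ is $\alpha(\mathcal{T})=\max_{t\in V(T)}\alpha(G[X_t])$, where $\alpha(H)$ is the maximum size of an independent set in $H$. The tree-independence number $\mathsf{tree}\text{-}\alpha(G)$ is the minimum of $\alpha(\mathcal{T})$ over all tree decompositions $\mathcal{T}$ of $G$. *)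

theory Defs
  imports "Graph_Theory.Digraph_Component"
begin

text \<open>
  A finite simple undirected graph is a \<^locale>\<open>pair_graph\<close>: finite vertex set, and a symmetric,
  irreflexive set of arcs, so that an edge \<open>uv\<close> is the pair of arcs \<open>(u, v)\<close>, \<open>(v, u)\<close>.
\<close>

definition cycle_graph :: "'a list \<Rightarrow> 'a pair_pre_digraph" where
  "cycle_graph c =
    \<lparr> pverts = set c,
      parcs = (\<Union>i<length c. {(c ! i, c ! (Suc i mod length c)), (c ! (Suc i mod length c), c ! i)}) \<rparr>"

definition chordal :: "'a pair_pre_digraph \<Rightarrow> bool" where
  "chordal G \<longleftrightarrow>
    \<not> (\<exists>c. 4 \<le> length c \<and> distinct c \<and> induced_subgraph (with_proj (cycle_graph c)) (with_proj G))"

text \<open>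
  The library's \<^const>\<open>tree\<close> is unsuitable for symmetric digraphs, since it counts the closed walk
  \<open>u, v, u\<close> along a single edge as a cycle.
\<close>

definition undirected_tree :: "'a pair_pre_digraph \<Rightarrow> bool" where
  "undirected_tree T \<longleftrightarrow>
    pair_graph T \<and> connected (with_proj T) \<and>
    \<not> (\<exists>c. 3 \<le> length c \<and> distinct c \<and> subgraph (with_proj (cycle_graph c)) (with_proj T))"

definition independent_set :: "('a, 'b) pre_digraph \<Rightarrow> 'a set \<Rightarrow> bool" where
  "independent_set H S \<longleftrightarrow> S \<subseteq> verts H \<and> (\<forall>u\<in>S. \<forall>v\<in>S. (u, v) \<notin> arcs_ends H)"

definition independence_number :: "('a, 'b) pre_digraph \<Rightarrow> nat" where
  "independence_number H = Max (card ` {S. independent_set H S})"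

definition tree_decomposition ::
    "'a pair_pre_digraph \<Rightarrow> 't pair_pre_digraph \<Rightarrow> ('t \<Rightarrow> 'a set) \<Rightarrow> bool" where
  "tree_decomposition G T X \<longleftrightarrow>
    undirected_tree T \<and>
    (\<forall>t\<in>pverts T. X t \<subseteq> pverts G) \<and>
    (\<forall>u\<in>pverts G. \<exists>t\<in>pverts T. u \<in> X t) \<and>
    (\<forall>(u, v)\<in>parcs G. \<exists>t\<in>pverts T. u \<in> X t \<and> v \<in> X t) \<and>
    (\<forall>u\<in>pverts G. connected (with_proj T \<restriction> {t \<in> pverts T. u \<in> X t}))"

definition decomposition_independence_number ::
    "'a pair_pre_digraph \<Rightarrow> 't pair_pre_digraph \<Rightarrow> ('t \<Rightarrow> 'a set) \<Rightarrow> nat" where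
  "decomposition_independence_number G T X =
    Max ((\<lambda>t. independence_number (with_proj G \<restriction> X t)) ` pverts T)"

text \<open>
  Trees are finite, so taking natural numbers as tree nodes covers all tree decompositions up to
  renaming of nodes.
\<close>

definition tree_alpha :: "'a pair_pre_digraph \<Rightarrow> nat" where
  "tree_alpha G =
    (LEAST k. \<exists>(T :: nat pair_pre_digraph) X.
      tree_decomposition G T X \<and> decomposition_independence_number G T X = k)"

end

theory Submission
  imports Defs
begin

text \<open>
  A decomposition has independence number at most 1 iff all its bags are cliques.

  Given such a decomposition and an induced cycle, restrict the bags to the cycle and prune leaves of
  the tree whose bag is contained in the neighbouring bag. Eventually some cycle vertex lies only in
  the bag of a leaf, so its neighbours are pairwise adjacent; this is impossible on a hole.

  Conversely, a chordal graph has a simplicial vertex (Dirac): for a component \<open>C\<close> of the graph minus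
  the closed neighbourhood of \<open>v\<close>, the neighbours of \<open>C\<close> outside \<open>C\<close> form a clique, and induction on
  the graph induced by \<open>C\<close> and these neighbours finds a simplicial vertex in \<open>C\<close>. Deleting simplicial
  vertices one by one and adding them back in reverse order builds a tree of cliques leaf by leaf.
\<close>

text \<open>This and the next notions take a bare relation and, where needed, a separate vertex set,
  so that deleting vertices only shrinks the set. Nonemptiness agrees with \<open>connected\<close>;
  for a vertex of the graph it says that some bag contains it.\<close>

definition connected_on :: "'a rel \<Rightarrow> 'a set \<Rightarrow> bool" where
  "connected_on E S \<longleftrightarrow> S \<noteq> {} \<and> (\<forall>u\<in>S. \<forall>v\<in>S. (u, v) \<in> rtrancl_on S E)"

definition clique :: "'a rel \<Rightarrow> 'a set \<Rightarrow> bool" where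
  "clique E A \<longleftrightarrow> (\<forall>x\<in>A. \<forall>y\<in>A. x \<noteq> y \<longrightarrow> (x, y) \<in> E)"

definition simplicial :: "'a rel \<Rightarrow> 'a set \<Rightarrow> 'a \<Rightarrow> bool" where
  "simplicial E W z \<longleftrightarrow> clique E {x \<in> W. (z, x) \<in> E}"

definition hole :: "'a rel \<Rightarrow> 'a list \<Rightarrow> bool" where
  "hole E c \<longleftrightarrow> 4 \<le> length c \<and> distinct c \<and> E \<inter> set c \<times> set c = parcs (cycle_graph c)"

text \<open>From length 3 on \<open>cycle_graph\<close> is a genuine cycle; on two distinct entries
  it is a single edge.\<close>

definition acyclic_graph :: "'a rel \<Rightarrow> bool" where
  "acyclic_graph E \<longleftrightarrow> \<not> (\<exists>c. 3 \<le> length c \<and> distinct c \<and> parcs (cycle_graph c) \<subseteq> E)"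

lemma clique_subset: "clique E B \<Longrightarrow> A \<subseteq> B \<Longrightarrow> clique E A"
  by (auto simp: clique_def)

subsection \<open>Cycles\<close>

lemma parcs_cycle_graph_subset: "parcs (cycle_graph c) \<subseteq> set c \<times> set c"
proof -
  have "Suc i mod length c < length c" if "i < length c" for i
    using that by (intro mod_less_divisor) auto
  then show ?thesis by (auto simp: cycle_graph_def)
qed

lemma pair_wf_digraph_cycle_graph: "pair_wf_digraph (cycle_graph c)"
  using parcs_cycle_graph_subset[of c]
  by unfold_locales (auto simp: cycle_graph_def)

lemma nth_in_parcs_cycle_graph_iff:
  assumes "distinct c" "i < length c" "j < length c"
  shows "(c ! i, c ! j) \<in> parcs (cycle_graph c) \<longleftrightarrow>
    j = Suc i mod length c \<or> i = Suc j mod length c"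
proof -
  have m: "Suc k mod length c < length c" if "k < length c" for k
    using that by (intro mod_less_divisor) auto
  show ?thesis
    using assms m by (auto simp: cycle_graph_def nth_eq_iff_index_eq)
qed

lemma parcs_cycle_graph_subsetI:
  assumes "sym E" "successively (\<lambda>x y. (x, y) \<in> E) c" "c \<noteq> []" "(last c, hd c) \<in> E"
  shows "parcs (cycle_graph c) \<subseteq> E"
proof -
  have "(c ! i, c ! (Suc i mod length c)) \<in> E" if "i < length c" for i
  proof (cases "Suc i = length c")
    case True
    then have "i = length c - 1" by simp
    then show ?thesis using True assms(3,4) by (simp add: last_conv_nth hd_conv_nth)
  next
    case False
    then have "Suc i < length c" using that by simp
    then show ?thesis using assms(2) by (auto simp: successively_conv_nth)
  qed
  then show ?thesis using \<open>sym E\<close> by (auto simp: cycle_graph_def dest: symD)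
qed

text \<open>The witnesses are the cyclic successor and predecessor of \<open>x\<close>. Length 3
  makes them distinct, which keeps leaves off cycles; length 4 makes them nonadjacent, which
  separates holes from triangles.\<close>

lemma cycle_graph_two_neighbours:
  assumes "distinct c" "3 \<le> length c" "x \<in> set c"
  obtains y z where "y \<in> set c" "z \<in> set c" "y \<noteq> z"
    "(x, y) \<in> parcs (cycle_graph c)" "(x, z) \<in> parcs (cycle_graph c)"
    "4 \<le> length c \<Longrightarrow> (y, z) \<notin> parcs (cycle_graph c)"
proof -
  obtain i where i: "i < length c" "x = c ! i" using assms(3) by (auto simp: in_set_conv_nth)
  \<comment> \<open>Successor and predecessor indices with the wrap-around spelled out, so that case
    splits replace modular arithmetic.\<close>
  define a where "a = (if Suc i = length c then 0 else Suc i)"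
  define b where "b = (if i = 0 then length c - 1 else i - 1)"
  have ab: "a < length c" "b < length c" "a \<noteq> b"
    using i assms(2) by (auto simp: a_def b_def)
  have m: "Suc k mod length c = (if Suc k = length c then 0 else Suc k)" if "k < length c" for k
    using that by auto
  show thesis
  proof (rule that)
    show "c ! a \<in> set c" "c ! b \<in> set c" "c ! a \<noteq> c ! b"
      using ab assms(1) by (auto simp: nth_eq_iff_index_eq)
    show "(x, c ! a) \<in> parcs (cycle_graph c)"
      using assms(1) i ab by (simp add: nth_in_parcs_cycle_graph_iff m a_def)
    show "(x, c ! b) \<in> parcs (cycle_graph c)"
      unfolding i(2) nth_in_parcs_cycle_graph_iff[OF assms(1) i(1) ab(2)] m[OF ab(2)]
      using i(1) assms(2) by (auto simp: b_def)
    show "(c ! a, c ! b) \<notin> parcs (cycle_graph c)" if "4 \<le> length c"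
      unfolding nth_in_parcs_cycle_graph_iff[OF assms(1) ab(1,2)] m[OF ab(1)] m[OF ab(2)]
      using i(1) that by (auto simp: a_def b_def split: if_splits)
  qed
qed

lemma not_simplicial_hole:
  assumes "hole E c" "x \<in> set c"
  shows "\<not> simplicial E (set c) x"
proof -
  have c: "4 \<le> length c" "distinct c" "E \<inter> set c \<times> set c = parcs (cycle_graph c)"
    using assms(1) by (auto simp: hole_def)
  then have "3 \<le> length c" by simp
  then obtain y z where "y \<in> set c" "z \<in> set c" "y \<noteq> z"
    "(x, y) \<in> parcs (cycle_graph c)" "(x, z) \<in> parcs (cycle_graph c)"
    "(y, z) \<notin> parcs (cycle_graph c)"
    using cycle_graph_two_neighbours[OF c(2) _ assms(2)] c(1) by metis
  then show ?thesis using c(3) unfolding simplicial_def clique_def by blast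
qed

text \<open>Well-formedness and compatibility hold automatically here, so an induced cycle reduces
  to vertex inclusion and an equality of arc sets.\<close>

lemma chordal_iff_no_hole:
  assumes "pair_graph G"
  shows "chordal G \<longleftrightarrow> (\<forall>c. set c \<subseteq> pverts G \<longrightarrow> \<not> hole (parcs G) c)"
proof -
  interpret pair_graph G by fact
  have "induced_subgraph (with_proj (cycle_graph c)) (with_proj G) \<longleftrightarrow>
      set c \<subseteq> pverts G \<and> parcs G \<inter> set c \<times> set c = parcs (cycle_graph c)" for c
  proof -
    have v: "pverts (cycle_graph c) = set c" by (simp add: cycle_graph_def)
    have "{e \<in> parcs G. fst e \<in> set c \<and> snd e \<in> set c} = parcs G \<inter> set c \<times> set c"
      by auto
    then show ?thesis
      unfolding induced_subgraph_def subgraph_def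
      using wf_digraph_axioms
      by (auto simp: v wf_digraph_wp_iff pair_wf_digraph_cycle_graph compatible_def)
  qed
  then show ?thesis unfolding chordal_def hole_def by blast
qed

subsection \<open>Trees\<close>

lemma rtrancl_on_Restr:
  assumes "S \<subseteq> V"
  shows "rtrancl_on S (F \<inter> V \<times> V) = rtrancl_on S F"
proof (intro equalityI subrelI)
  fix u v assume "(u, v) \<in> rtrancl_on S F"
  then show "(u, v) \<in> rtrancl_on S (F \<inter> V \<times> V)"
    using assms by (induct rule: rtrancl_on_induct) (auto intro: rtrancl_on_into_rtrancl_on)
qed (auto elim: rtrancl_on_mono[rotated 2])

text \<open>\<open>connected\<close> works with the symmetric closure, which adds nothing to
  symmetric arcs; walks inside \<open>S\<close> take only arcs inside \<open>S\<close>.\<close>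

lemma connected_restrict_iff:
  assumes "sym (parcs T)"
  shows "connected (with_proj T \<restriction> S) \<longleftrightarrow> connected_on (parcs T) S"
proof -
  have "(arcs_ends (with_proj T \<restriction> S))\<^sup>s = parcs T \<inter> S \<times> S"
    using assms by (auto simp: symcl_def arcs_ends_conv induce_subgraph_def dest: symD)
  then show ?thesis by (simp add: connected_conv connected_on_def rtrancl_on_Restr)
qed

lemma connected_with_proj_iff:
  assumes "sym (parcs T)"
  shows "connected (with_proj T) \<longleftrightarrow> connected_on (parcs T) (pverts T)"
proof -
  have "(parcs T)\<^sup>s = parcs T" using assms by (auto simp: symcl_def dest: symD)
  then show ?thesis by (simp add: connected_conv connected_on_def)
qed

lemma undirected_tree_iff:
  "undirected_tree T \<longleftrightarrow>
    pair_graph T \<and> connected_on (parcs T) (pverts T) \<and> acyclic_graph (parcs T)"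
proof (cases "pair_graph T")
  case True
  then interpret pair_graph T .
  have "sym (parcs T)" using pair_sym_arcs by (simp add: symmetric_def)
  moreover have "subgraph (with_proj (cycle_graph c)) (with_proj T) \<longleftrightarrow>
      parcs (cycle_graph c) \<subseteq> parcs T" if "3 \<le> length c" "distinct c" for c
  proof
    assume arcs: "parcs (cycle_graph c) \<subseteq> parcs T"
    \<comment> \<open>Every entry of \<open>c\<close> is the tail of an arc of the cycle, hence of
      an arc of \<open>T\<close>.\<close>
    have "set c \<subseteq> pverts T"
      using cycle_graph_two_neighbours[OF that(2,1)] arcs in_arcsD1 by blast
    moreover have v: "pverts (cycle_graph c) = set c" by (simp add: cycle_graph_def)
    ultimately show "subgraph (with_proj (cycle_graph c)) (with_proj T)"
      using arcs wf_digraph_axioms unfolding subgraph_def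
      by (auto simp: wf_digraph_wp_iff pair_wf_digraph_cycle_graph compatible_def v)
  qed (auto simp: subgraph_def)
  ultimately show ?thesis
    using True by (auto simp: undirected_tree_def connected_with_proj_iff acyclic_graph_def)
qed (simp add: undirected_tree_def)

text \<open>The first vertex of a longest path has all its neighbours on the path, and a neighbour
  beyond the second vertex would close a cycle. An isolated vertex counts as a leaf, so forests are
  covered.\<close>

lemma acyclic_graph_leaf:
  assumes "finite V" "V \<noteq> {}" "E \<subseteq> V \<times> V" "sym E" "irrefl E" "acyclic_graph E"
  obtains l where "l \<in> V" "\<And>p q. (l, p) \<in> E \<Longrightarrow> (l, q) \<in> E \<Longrightarrow> p = q"
proof -
  define path where "path xs \<longleftrightarrow> xs \<noteq> [] \<and> distinct xs \<and> set xs \<subseteq> V \<and>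
    successively (\<lambda>x y. (x, y) \<in> E) xs" for xs
  have bound: "length xs \<le> card V" if "path xs" for xs
    using that assms(1) by (auto simp: path_def distinct_card[symmetric] intro: card_mono)
  obtain v where "v \<in> V" using assms(2) by blast
  then have "path [v]" by (simp add: path_def)
  then obtain xs where xs: "path xs" and longest: "\<And>ys. path ys \<Longrightarrow> length ys \<le> length xs"
    using bound ex_has_greatest_nat[of path "[v]" length "Suc (card V)"] by (metis le_imp_less_Suc)
  have ne: "xs \<noteq> []" using xs by (simp add: path_def)
  have second: "z = xs ! 1" if z: "(hd xs, z) \<in> E" for z
  proof -
    have "(z, hd xs) \<in> E" "z \<in> V" using z assms(3,4) by (auto dest: symD)
    \<comment> \<open>Otherwise \<open>z # xs\<close> would be a longer path.\<close>
    then have "z \<in> set xs"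
      using longest[of "z # xs"] xs ne by (auto simp: path_def successively_Cons)
    then obtain k where k: "k < length xs" "z = xs ! k" by (auto simp: in_set_conv_nth)
    have "z \<noteq> hd xs" using z assms(5) by (auto simp: irrefl_def)
    then have "k \<noteq> 0" using k ne by (metis hd_conv_nth)
    moreover have "\<not> 2 \<le> k"
    proof
      assume "2 \<le> k"
      \<comment> \<open>The initial segment ending in \<open>z\<close>, closed by the arc back to
        \<open>hd xs\<close>; \<open>2 \<le> k\<close> gives it at least three vertices.\<close>
      define c where "c = take (Suc k) xs"
      have c: "3 \<le> length c" "distinct c" "last c = z" "hd c = hd xs" "c \<noteq> []"
        using \<open>2 \<le> k\<close> k xs ne
        by (auto simp: c_def path_def last_conv_nth hd_conv_nth)
      have "successively (\<lambda>x y. (x, y) \<in> E) (c @ drop (Suc k) xs)"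
        using xs by (simp add: c_def path_def)
      then have "successively (\<lambda>x y. (x, y) \<in> E) c" by (simp only: successively_append_iff)
      then have "parcs (cycle_graph c) \<subseteq> E"
        using c \<open>(z, hd xs) \<in> E\<close> assms(4) by (intro parcs_cycle_graph_subsetI) auto
      then show False using c assms(6) by (auto simp: acyclic_graph_def)
    qed
    ultimately have "k = 1" by linarith
    then show ?thesis using k by simp
  qed
  show thesis
  proof (rule that)
    show "hd xs \<in> V" using xs ne by (auto simp: path_def)
  qed (use second in blast)
qed

text \<open>A walk that visits a leaf enters and leaves it through the same neighbour, so the detour
  can be cut out.\<close>

lemma connected_on_remove_leaf:
  assumes "connected_on E S" "sym E" "\<And>p q. (l, p) \<in> E \<Longrightarrow> (l, q) \<in> E \<Longrightarrow> p = q" "S \<noteq> {l}"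
  shows "connected_on E (S - {l})"
proof -
  \<comment> \<open>While the walk stands at \<open>l\<close>, the invariant remembers that the
    neighbour of \<open>l\<close> has already been reached without \<open>l\<close>; this is what
    the step away from \<open>l\<close> requires.\<close>
  have "if v = l then (\<forall>p. (l, p) \<in> E \<longrightarrow> (u, p) \<in> rtrancl_on (S - {l}) E)
      else (u, v) \<in> rtrancl_on (S - {l}) E"
    if "(u, v) \<in> rtrancl_on S E" "u \<noteq> l" for u v
    using that(1)
  proof (induct rule: rtrancl_on_induct)
    case base
    then show ?case using that(2) by auto
  next
    case (step y z)
    show ?case
    proof (cases "z = l")
      case True
      then have ly: "(l, y) \<in> E" using step(2) assms(2) by (auto dest: symD)
      show ?thesis
      proof (cases "y = l")
        case True
        then show ?thesis using step \<open>z = l\<close> by simp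
      next
        case False
        then show ?thesis using step(5) \<open>z = l\<close> ly assms(3) by metis
      qed
    next
      case False
      show ?thesis
      proof (cases "y = l")
        case True
        then show ?thesis using step False by simp
      next
        case yl: False
        then show ?thesis using step False by (auto intro: rtrancl_on_into_rtrancl_on)
      qed
    qed
  qed
  then show ?thesis using assms(1,4) unfolding connected_on_def
    by (metis Diff_iff Diff_eq_empty_iff empty_iff insert_iff subset_singletonD)
qed

text \<open>Applied to the nodes whose bags contain a vertex, this moves the vertex from the bag of
  a leaf to the bag of its neighbour.\<close>

lemma connected_on_leaf_neighbour:
  assumes "connected_on E S" "l \<in> S" "S \<noteq> {l}"
  obtains p where "p \<in> S" "(l, p) \<in> E" "p \<noteq> l"
proof -
  obtain u where "u \<in> S" "u \<noteq> l" using assms(2,3) by blast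
  then have "(l, u) \<in> rtrancl_on S E" using assms by (auto simp: connected_on_def)
  then have "u = l \<or> (\<exists>p\<in>S. (l, p) \<in> E \<and> p \<noteq> l)"
    by induct auto
  then show thesis using that \<open>u \<noteq> l\<close> by blast
qed

lemma connected_on_insert_leaf:
  assumes "connected_on E S" "t \<in> S" "(l, t) \<in> F" "(t, l) \<in> F" "E \<subseteq> F"
  shows "connected_on F (insert l S)"
proof -
  let ?R = "rtrancl_on (insert l S) F"
  have S: "(u, v) \<in> ?R" if "u \<in> S" "v \<in> S" for u v
    using assms(1,5) that by (auto simp: connected_on_def intro: rtrancl_on_mono[of E F S])
  have "(u, l) \<in> ?R" if "u \<in> insert l S" for u
    using S[of u t] that assms(2,4) by (auto intro: rtrancl_on_into_rtrancl_on)
  moreover have "(l, v) \<in> ?R" if "v \<in> insert l S" for v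
    using S[of t v] that assms(2,3) by (auto intro: converse_rtrancl_on_into_rtrancl_on)
  ultimately show ?thesis using S by (auto simp: connected_on_def)
qed

text \<open>A cycle through \<open>l\<close> would need two distinct neighbours of \<open>l\<close>,
  but \<open>t\<close> is the only one; a cycle avoiding \<open>l\<close> already lies in
  \<open>T\<close>.\<close>

lemma undirected_tree_insert_leaf:
  assumes "undirected_tree T" "t \<in> pverts T" "l \<notin> pverts T"
  shows "undirected_tree
    \<lparr> pverts = insert l (pverts T), parcs = parcs T \<union> {(l, t), (t, l)} \<rparr>" (is "undirected_tree ?T")
proof -
  interpret pair_graph T using assms(1) by (simp add: undirected_tree_iff)
  have "sym (parcs T)" using pair_sym_arcs by (simp add: symmetric_def)
  then have "sym (parcs ?T)" by (auto simp: sym_def)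
  then have "pair_graph ?T"
    using assms(2,3) pair_finite_verts pair_finite_arcs in_arcsD1 in_arcsD2 no_loops'
    by unfold_locales (auto simp: symmetric_def)
  moreover have "connected_on (parcs ?T) (pverts ?T)"
    using assms(1,2) by (auto simp: undirected_tree_iff intro: connected_on_insert_leaf)
  moreover have "acyclic_graph (parcs ?T)"
    unfolding acyclic_graph_def
  proof clarify
    fix c assume c: "3 \<le> length c" "distinct c" "parcs (cycle_graph c) \<subseteq> parcs ?T"
    have leaf: "x = t" if "(l, x) \<in> parcs ?T" for x
      using that assms(2,3) in_arcsD1 by auto
    have "l \<notin> set c"
    proof
      assume "l \<in> set c"
      then obtain y z where "y \<noteq> z" "(l, y) \<in> parcs (cycle_graph c)" "(l, z) \<in> parcs (cycle_graph c)"
        using cycle_graph_two_neighbours[OF c(2,1)] by metis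
      then show False using leaf c(3) by blast
    qed
    then have "parcs (cycle_graph c) \<subseteq> parcs T"
      using c(3) parcs_cycle_graph_subset[of c] by auto
    then show False using c assms(1) by (auto simp: undirected_tree_iff acyclic_graph_def)
  qed
  ultimately show ?thesis by (simp add: undirected_tree_iff)
qed

subsection \<open>From clique trees to simplicial vertices\<close>

text \<open>Induction on the number of nodes, with \<open>U\<close> and the bags fixed. Removing a
  leaf preserves all hypotheses unless some vertex of \<open>U\<close> occurs in the bag of that
  leaf alone; such a vertex is simplicial.\<close>

lemma clique_forest_simplicial:
  assumes "finite V" "F \<subseteq> V \<times> V" "sym F" "irrefl F" "acyclic_graph F"
    and "U \<noteq> {}"
    and "\<And>u. u \<in> U \<Longrightarrow> connected_on F {t \<in> V. u \<in> X t}"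
    and "\<And>u v. u \<in> U \<Longrightarrow> v \<in> U \<Longrightarrow> (u, v) \<in> E \<Longrightarrow> \<exists>t\<in>V. u \<in> X t \<and> v \<in> X t"
    and "\<And>t. t \<in> V \<Longrightarrow> clique E (X t)"
  shows "\<exists>u\<in>U. simplicial E U u"
  using assms
proof (induction "card V" arbitrary: V F rule: less_induct)
  case less
  obtain u0 where "u0 \<in> U" using \<open>U \<noteq> {}\<close> by blast
  then have "V \<noteq> {}" using less.prems(7) by (force simp: connected_on_def)
  then obtain l where l: "l \<in> V" "\<And>p q. (l, p) \<in> F \<Longrightarrow> (l, q) \<in> F \<Longrightarrow> p = q"
    using acyclic_graph_leaf[OF less.prems(1) _ less.prems(2-5)] by metis
  show ?case
  proof (cases "\<exists>u\<in>U. {t \<in> V. u \<in> X t} = {l}")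
    case True
    then obtain u where u: "u \<in> U" "{t \<in> V. u \<in> X t} = {l}" by blast
    \<comment> \<open>Each edge at \<open>u\<close> lies in a bag containing \<open>u\<close>, and
      \<open>X l\<close> is the only one.\<close>
    have "{x \<in> U. (u, x) \<in> E} \<subseteq> X l"
    proof
      fix x assume "x \<in> {x \<in> U. (u, x) \<in> E}"
      then obtain t where t: "t \<in> {t \<in> V. u \<in> X t}" "x \<in> X t" using less.prems(8) u(1) by blast
      then show "x \<in> X l" unfolding u(2) by simp
    qed
    then have "simplicial E U u"
      using less.prems(9)[OF l(1)] by (auto simp: simplicial_def intro: clique_subset)
    then show ?thesis using u by blast
  next
    case False
    let ?V = "V - {l}" and ?F = "F \<inter> (V - {l}) \<times> (V - {l})"
    \<comment> \<open>No vertex of \<open>U\<close> is confined to \<open>X l\<close> in this case,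
      so its connected node set must continue to a neighbour of \<open>l\<close>.\<close>
    have move: "\<exists>p\<in>?V. (l, p) \<in> F \<and> u \<in> X p" if "u \<in> U" "u \<in> X l" for u
      using connected_on_leaf_neighbour[OF less.prems(7)[OF that(1)], of l] False that l(1) by blast
    show ?thesis
    proof (rule less.hyps[of ?V ?F])
      show "card ?V < card V" using l(1) less.prems(1) by (rule card_Diff1_less[rotated])
      show "sym ?F" using less.prems(3) by (auto simp: sym_def)
      show "irrefl ?F" using less.prems(4) by (auto simp: irrefl_def)
      show "acyclic_graph ?F" using less.prems(5) by (auto simp: acyclic_graph_def)
      show "connected_on ?F {t \<in> ?V. u \<in> X t}" if "u \<in> U" for u
      proof -
        have "connected_on F ({t \<in> V. u \<in> X t} - {l})"
          using False that by (intro connected_on_remove_leaf less.prems(3,7) l(2)) auto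
        moreover have "{t \<in> V. u \<in> X t} - {l} = {t \<in> ?V. u \<in> X t}" by auto
        ultimately have "connected_on F {t \<in> ?V. u \<in> X t}" by simp
        moreover have "{t \<in> ?V. u \<in> X t} \<subseteq> ?V" by blast
        ultimately show ?thesis by (simp add: connected_on_def rtrancl_on_Restr del: Collect_empty_eq)
      qed
      show "\<exists>t\<in>?V. u \<in> X t \<and> v \<in> X t" if uv: "u \<in> U" "v \<in> U" "(u, v) \<in> E" for u v
      proof -
        obtain t where t: "t \<in> V" "u \<in> X t" "v \<in> X t" using less.prems(8)[OF uv] by blast
        show ?thesis
        proof (cases "t = l")
          case True
          \<comment> \<open>Both endpoints move to a neighbour of \<open>l\<close>, and it is the
            same one because \<open>l\<close> is a leaf.\<close>
          then show ?thesis using move[OF uv(1)] move[OF uv(2)] t l(2) by metis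
        qed (use t in blast)
      qed
    qed (use less.prems in auto)
  qed
qed

subsection \<open>Simplicial vertices of chordal graphs\<close>

text \<open>A walk of least length is an induced path, since a repeated vertex or a chord would
  yield a shorter walk.\<close>

lemma shortest_path:
  assumes "(x, y) \<in> rtrancl_on A E"
  obtains q where "q \<noteq> []" "hd q = x" "last q = y" "set q \<subseteq> A" "distinct q"
    "\<And>i j. i < j \<Longrightarrow> j < length q \<Longrightarrow> (q ! i, q ! j) \<in> E \<longleftrightarrow> j = Suc i"
proof -
  define walk where "walk q \<longleftrightarrow> q \<noteq> [] \<and> hd q = x \<and> last q = y \<and> set q \<subseteq> A \<and>
    successively (\<lambda>x y. (x, y) \<in> E) q" for q
  have "\<exists>q. q \<noteq> [] \<and> hd q = x \<and> last q = y \<and> set q \<subseteq> A \<and> successively (\<lambda>x y. (x, y) \<in> E) q"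
    using assms
  proof (induct rule: rtrancl_on_induct)
    case base
    then show ?case by (intro exI[of _ "[x]"]) auto
  next
    case (step y z)
    then obtain q where "q \<noteq> []" "hd q = x" "last q = y" "set q \<subseteq> A"
      "successively (\<lambda>x y. (x, y) \<in> E) q" by blast
    then show ?case using step(2,4)
      by (intro exI[of _ "q @ [z]"]) (auto simp: successively_append_iff)
  qed
  then have "\<exists>q. walk q" by (simp add: walk_def)
  then obtain q where q: "walk q" and shortest: "\<And>p. walk p \<Longrightarrow> length q \<le> length p"
    using ex_has_least_nat[of walk _ length] by blast
  \<comment> \<open>The first \<open>k\<close> entries are spliced to the tail starting at
    \<open>j\<close>; minimality forces \<open>k = j\<close>. Repetitions use \<open>k = i\<close>,
    chords use \<open>k = Suc i\<close>. If \<open>k = 0\<close>, the tail itself has to start at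
    \<open>x\<close>.\<close>
  have shortcut: "k = j" if "i \<le> j" "j < length q" "k \<le> j" "k \<le> i + 1"
    "k = 0 \<Longrightarrow> q ! j = x" "0 < k \<Longrightarrow> (q ! (k - 1), q ! j) \<in> E" for i j k
  proof -
    let ?p = "take k q @ drop j q"
    have k: "k < length q" using that by simp
    have "successively (\<lambda>x y. (x, y) \<in> E) (take k q @ drop k q)"
      "successively (\<lambda>x y. (x, y) \<in> E) (take j q @ drop j q)"
      using q by (simp_all add: walk_def)
    then have "successively (\<lambda>x y. (x, y) \<in> E) (take k q)"
      "successively (\<lambda>x y. (x, y) \<in> E) (drop j q)"
      by (simp_all only: successively_append_iff)
    moreover have "last (take k q) = q ! (k - 1)" if "0 < k"
      using k that by (subst last_conv_nth) (auto simp: min_def)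
    ultimately have "successively (\<lambda>x y. (x, y) \<in> E) ?p"
      using that(2,6) k by (auto simp: successively_append_iff hd_drop_conv_nth)
    moreover have "hd ?p = x"
      using that(2,5) q k by (cases "k = 0") (auto simp: walk_def hd_drop_conv_nth hd_append)
    moreover have "last ?p = y" using that(2) q by (simp add: walk_def)
    moreover have "set ?p \<subseteq> A"
      using q set_take_subset[of k q] set_drop_subset[of j q] by (auto simp: walk_def)
    ultimately have "walk ?p" using that(2) by (simp add: walk_def)
    from shortest[OF this] show ?thesis using that(2,3) k by simp
  qed
  have succ: "(q ! i, q ! Suc i) \<in> E" if "Suc i < length q" for i
    using q that by (auto simp: walk_def successively_conv_nth)
  have "q ! i \<noteq> q ! j" if "i < j" "j < length q" for i j
  proof
    assume eq: "q ! i = q ! j"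
    have "q ! 0 = x" using q by (auto simp: walk_def hd_conv_nth)
    then have "i = j"
      using that eq succ[of "i - 1"] by (intro shortcut[of i]) auto
    then show False using that by simp
  qed
  then have "distinct q" by (metis distinct_conv_nth linorder_neqE_nat)
  moreover have "(q ! i, q ! j) \<in> E \<longleftrightarrow> j = Suc i" if "i < j" "j < length q" for i j
    using shortcut[of i j "Suc i"] succ[of i] that by auto
  ultimately show thesis using q that by (auto simp: walk_def)
qed

text \<open>A shortest path between the two vertices, closed up through \<open>v\<close>, would be a hole.\<close>

lemma component_attachments_adjacent:
  assumes "sym E" "irrefl E" "\<And>c. set c \<subseteq> W \<Longrightarrow> \<not> hole E c"
    and "v \<in> W" "C \<subseteq> W" "v \<notin> C" "\<And>z. z \<in> C \<Longrightarrow> (v, z) \<notin> E"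
    and "connected_on E C"
    and x: "x \<in> W" "(v, x) \<in> E" "a \<in> C" "(x, a) \<in> E"
    and y: "y \<in> W" "(v, y) \<in> E" "b \<in> C" "(y, b) \<in> E"
    and "x \<noteq> y"
  shows "(x, y) \<in> E"
proof (rule ccontr)
  assume nadj: "(x, y) \<notin> E"
  \<comment> \<open>Walks within this set have all vertices other than \<open>x\<close> and
    \<open>y\<close> in \<open>C\<close>, away from the neighbours of \<open>v\<close>.\<close>
  let ?A = "C \<union> {x, y}"
  have "(a, b) \<in> rtrancl_on ?A E"
    using assms(8) x(3) y(3) by (auto simp: connected_on_def intro: rtrancl_on_mono[of E E C])
  then have "(x, b) \<in> rtrancl_on ?A E"
    using x(4) by (auto intro: converse_rtrancl_on_into_rtrancl_on)
  then have "(x, y) \<in> rtrancl_on ?A E"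
    using y(4) assms(1) by (auto intro: rtrancl_on_into_rtrancl_on dest: symD)
  then obtain q where q: "q \<noteq> []" "hd q = x" "last q = y" "set q \<subseteq> ?A" "distinct q"
    and adj: "\<And>i j. i < j \<Longrightarrow> j < length q \<Longrightarrow> (q ! i, q ! j) \<in> E \<longleftrightarrow> j = Suc i"
    by (rule shortest_path) blast
  define m where "m = length q - 1"
  have m: "length q = Suc m" "q ! 0 = x" "q ! m = y"
    using q(1-3) by (auto simp: m_def hd_conv_nth last_conv_nth)
  have "m \<noteq> 0" using m \<open>x \<noteq> y\<close> by metis
  moreover have "m \<noteq> 1" using adj[of 0 1] m nadj by auto
  \<comment> \<open>The path has an inner vertex, so closing it through \<open>v\<close> gives a
    cycle of length at least 4.\<close>
  ultimately have "2 \<le> m" by simp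
  have loop: "(z, z) \<notin> E" for z using assms(2) by (auto simp: irrefl_def)
  have sym: "(z, w) \<in> E \<longleftrightarrow> (w, z) \<in> E" for z w using assms(1) by (auto dest: symD)
  have qE: "(q ! i, q ! j) \<in> E \<longleftrightarrow> j = Suc i \<or> i = Suc j" if "i \<le> m" "j \<le> m" for i j
  proof (cases i j rule: linorder_cases)
    case less
    then show ?thesis using adj[of i j] that m by auto
  next
    case equal
    then show ?thesis using loop by auto
  next
    case greater
    then show ?thesis using adj[of j i] that m sym[of "q ! i"] by auto
  qed
  have vE: "(v, q ! i) \<in> E \<longleftrightarrow> i = 0 \<or> i = m" if "i \<le> m" for i
  proof
    assume "(v, q ! i) \<in> E"
    moreover have "q ! i \<in> ?A" using that m q(4) by (metis less_Suc_eq_le nth_mem subsetD)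
    ultimately have "q ! i = q ! 0 \<or> q ! i = q ! m" using m assms(7) by auto
    then show "i = 0 \<or> i = m" using q(5) that m by (auto simp: nth_eq_iff_index_eq)
  qed (use m x(2) y(2) in auto)
  have Ev: "(q ! i, v) \<in> E \<longleftrightarrow> i = 0 \<or> i = m" if "i \<le> m" for i
    using vE[OF that] sym by blast
  let ?c = "v # q"
  have "v \<notin> set q" using q(4) assms(6) loop x(2) y(2) by auto
  then have d: "distinct ?c" using q(5) by simp
  have *: "(?c ! i, ?c ! j) \<in> E \<longleftrightarrow> (?c ! i, ?c ! j) \<in> parcs (cycle_graph ?c)"
    if ij: "i < length ?c" "j < length ?c" for i j
  proof -
    \<comment> \<open>In \<open>?c\<close> index 0 is \<open>v\<close> and index
      \<open>Suc i\<close> is \<open>q ! i\<close>, so the last index is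
      \<open>Suc m\<close>.\<close>
    have md: "Suc k mod length ?c = (if k = Suc m then 0 else Suc k)" if "k < length ?c" for k
      using that m by auto
    show ?thesis
      unfolding nth_in_parcs_cycle_graph_iff[OF d ij] md[OF ij(1)] md[OF ij(2)]
      using ij m \<open>2 \<le> m\<close>
      by (cases i; cases j) (auto simp: loop vE Ev qE)
  qed
  have "E \<inter> set ?c \<times> set ?c = parcs (cycle_graph ?c)"
  proof (intro equalityI subrelI)
    fix z w assume "(z, w) \<in> E \<inter> set ?c \<times> set ?c"
    then show "(z, w) \<in> parcs (cycle_graph ?c)"
      using * by (metis IntE SigmaE2 in_set_conv_nth)
  next
    fix z w assume zw: "(z, w) \<in> parcs (cycle_graph ?c)"
    then have "(z, w) \<in> set ?c \<times> set ?c" using parcs_cycle_graph_subset[of ?c] by blast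
    then show "(z, w) \<in> E \<inter> set ?c \<times> set ?c"
      using * zw by (metis IntI SigmaE2 in_set_conv_nth)
  qed
  then have "hole E ?c" using d m \<open>2 \<le> m\<close> by (simp add: hole_def)
  moreover have "set ?c \<subseteq> W" using q(4) assms(4,5) x(1) y(1) by auto
  ultimately show False using assms(3) by blast
qed

text \<open>Asking for a simplicial vertex nonadjacent to a prescribed \<open>v\<close> carries the
  induction: with a suitable prescribed vertex in \<open>C \<union> S\<close>, the simplicial vertex
  found cannot fall into \<open>S\<close>.\<close>

lemma dirac_simplicial_nonneighbour:
  assumes "finite W" "sym E" "irrefl E" "\<And>c. set c \<subseteq> W \<Longrightarrow> \<not> hole E c"
    and "v \<in> W" "u \<in> W" "u \<noteq> v" "(v, u) \<notin> E"
  shows "\<exists>z\<in>W. z \<noteq> v \<and> (v, z) \<notin> E \<and> simplicial E W z"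
  using assms(1,4-)
proof (induction "card W" arbitrary: W u v rule: less_induct)
  case less
  define M where "M = {z \<in> W. z \<noteq> v \<and> (v, z) \<notin> E}"
  define C where "C = {z. (u, z) \<in> rtrancl_on M E}"
  define S where "S = {x \<in> W. (v, x) \<in> E \<and> (\<exists>a\<in>C. (x, a) \<in> E)}"
  have "u \<in> M" using less.prems by (auto simp: M_def)
  then have "u \<in> C" by (simp add: C_def)
  have CM: "C \<subseteq> M" by (auto simp: C_def dest: in_rtrancl_on_in_F)
  have sub: "C \<union> S \<subseteq> W" using CM by (auto simp: M_def S_def)
  \<comment> \<open>Vertices of \<open>C\<close> have no neighbours in \<open>W\<close> outside
    \<open>C \<union> S\<close>; hence simpliciality there lifts to \<open>W\<close>.\<close>
  have nbr: "x \<in> C \<union> S" if "z \<in> C" "x \<in> W" "(z, x) \<in> E" for x z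
  proof (cases "x \<in> M")
    case True
    then show ?thesis using that by (auto simp: C_def intro: rtrancl_on_into_rtrancl_on)
  next
    case False
    have "(x, z) \<in> E" using that(3) assms(2) by (auto dest: symD)
    moreover have "x \<noteq> v" using that CM assms(2) by (auto simp: M_def dest: symD)
    ultimately show ?thesis using False that by (auto simp: M_def S_def)
  qed
  have "connected_on E C"
  proof -
    have reach: "(u, z) \<in> rtrancl_on C E" if "(u, z) \<in> rtrancl_on M E" for z
      using that
    proof (induct rule: rtrancl_on_induct)
      case (step y z)
      then have "z \<in> C" by (auto simp: C_def intro: rtrancl_on_into_rtrancl_on)
      then show ?case using step by (auto intro: rtrancl_on_into_rtrancl_on)
    qed (use \<open>u \<in> C\<close> in auto)
    have "(z, w) \<in> rtrancl_on C E" if "z \<in> C" "w \<in> C" for z w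
    proof (rule rtrancl_on_trans)
      show "(z, u) \<in> rtrancl_on C E"
        using reach that(1) symD[OF rtrancl_on_sym[OF assms(2)]] by (auto simp: C_def)
      show "(u, w) \<in> rtrancl_on C E" using reach that(2) by (auto simp: C_def)
    qed
    then show ?thesis using \<open>u \<in> C\<close> by (auto simp: connected_on_def)
  qed
  have S: "(x, y) \<in> E" if xy: "x \<in> S" "y \<in> S" "x \<noteq> y" for x y
  proof -
    obtain a b where ab: "a \<in> C" "(x, a) \<in> E" "b \<in> C" "(y, b) \<in> E"
      and W: "x \<in> W" "(v, x) \<in> E" "y \<in> W" "(v, y) \<in> E"
      using xy by (auto simp: S_def)
    have C: "C \<subseteq> W" "v \<notin> C" "\<And>z. z \<in> C \<Longrightarrow> (v, z) \<notin> E" using CM by (auto simp: M_def)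
    show ?thesis
      by (rule component_attachments_adjacent[OF assms(2,3) less.prems(2,3) C \<open>connected_on E C\<close>
        W(1,2) ab(1,2) W(3,4) ab(3,4) xy(3)])
  qed
  have lift: ?case if "z \<in> C" "simplicial E (C \<union> S) z" for z
  proof -
    have "{x \<in> W. (z, x) \<in> E} \<subseteq> {x \<in> C \<union> S. (z, x) \<in> E}" using nbr that(1) by auto
    then have "simplicial E W z" using that(2) by (auto simp: simplicial_def intro: clique_subset)
    then show ?thesis using that(1) CM by (auto simp: M_def)
  qed
  show ?case
  proof (cases "clique E (C \<union> S)")
    case True
    then have "simplicial E (C \<union> S) u" by (auto simp: simplicial_def intro: clique_subset)
    then show ?thesis using lift \<open>u \<in> C\<close> by blast
  next
    case False
    \<comment> \<open>Losing \<open>v\<close> makes the vertex set strictly smaller.\<close>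
    have "v \<notin> C \<union> S" using CM assms(3) by (auto simp: M_def S_def irrefl_def)
    then have "card (C \<union> S) < card W"
      using sub less.prems(1,3) by (intro psubset_card_mono) auto
    moreover have "finite (C \<union> S)" using sub less.prems(1) finite_subset by blast
    moreover have "\<not> hole E c" if "set c \<subseteq> C \<union> S" for c using that sub less.prems(2) by blast
    ultimately have IH: "\<exists>z\<in>C \<union> S. z \<noteq> w \<and> (w, z) \<notin> E \<and> simplicial E (C \<union> S) z"
      if "w \<in> C \<union> S" "w' \<in> C \<union> S" "w' \<noteq> w" "(w, w') \<notin> E" for w w'
      using less.hyps[of "C \<union> S" w w'] that by blast
    show ?thesis
    proof (cases "\<exists>s\<in>S. \<exists>w\<in>C \<union> S. w \<noteq> s \<and> (s, w) \<notin> E")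
      \<comment> \<open>Prescribing \<open>s\<close> gives a \<open>z\<close> nonadjacent to
        \<open>s\<close>; as \<open>S\<close> is a clique, \<open>z\<close> lies in
        \<open>C\<close>.\<close>
      case True
      then obtain s w where "s \<in> S" "w \<in> C \<union> S" "w \<noteq> s" "(s, w) \<notin> E" by blast
      then obtain z where "z \<in> C \<union> S" "z \<noteq> s" "(s, z) \<notin> E" "simplicial E (C \<union> S) z"
        using IH[of s w] by blast
      then show ?thesis using lift S[OF \<open>s \<in> S\<close>] by blast
    next
      \<comment> \<open>Every vertex of \<open>S\<close> is now adjacent to all others, whereas
        \<open>z\<close> misses \<open>w\<close>, so \<open>z\<close> lies in
        \<open>C\<close>.\<close>
      case universal: False
      obtain w w' where w: "w \<in> C \<union> S" "w' \<in> C \<union> S" "w' \<noteq> w" "(w, w') \<notin> E"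
        using False by (auto simp: clique_def)
      then obtain z where z: "z \<in> C \<union> S" "z \<noteq> w" "(w, z) \<notin> E" "simplicial E (C \<union> S) z"
        using IH[of w w'] by blast
      have "(z, w) \<notin> E" using z(3) assms(2) by (auto dest: symD)
      then have "z \<notin> S" using universal z(2) w(1) by metis
      then show ?thesis using lift[of z] z(1,4) by blast
    qed
  qed
qed

lemma dirac_simplicial:
  assumes "finite W" "sym E" "irrefl E" "\<And>c. set c \<subseteq> W \<Longrightarrow> \<not> hole E c" "W \<noteq> {}"
  obtains z where "z \<in> W" "simplicial E W z"
proof (cases "clique E W")
  case True
  then have "simplicial E W z" for z by (auto simp: simplicial_def intro: clique_subset)
  then show thesis using that assms(5) by blast
next
  case False
  then obtain v u where "v \<in> W" "u \<in> W" "u \<noteq> v" "(v, u) \<notin> E" by (auto simp: clique_def)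
  then show thesis using dirac_simplicial_nonneighbour[OF assms(1-4)] that by blast
qed

subsection \<open>Clique trees of chordal graphs\<close>

lemma undirected_tree_singleton:
  "undirected_tree \<lparr> pverts = {t}, parcs = {} \<rparr>" (is "undirected_tree ?T")
proof -
  have "pair_graph ?T" by unfold_locales (auto simp: symmetric_def sym_def)
  moreover have "\<not> parcs (cycle_graph c) \<subseteq> {}" if "3 \<le> length c" "distinct c" for c
    using that cycle_graph_two_neighbours[of c "hd c"]
    by (metis empty_iff hd_in_set list.size(3) not_numeral_le_zero subsetD)
  ultimately show ?thesis by (auto simp: undirected_tree_iff connected_on_def acyclic_graph_def)
qed

text \<open>The third clause, stronger than what a tree decomposition asks for, provides the node to which
  the bag of a new simplicial vertex is attached.\<close>

lemma clique_tree_exists: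
  assumes "finite W" "sym E" "irrefl E" "\<forall>c. set c \<subseteq> W \<longrightarrow> \<not> hole E c"
  shows "\<exists>(T :: nat pair_pre_digraph) X. undirected_tree T \<and>
    (\<forall>t\<in>pverts T. X t \<subseteq> W \<and> clique E (X t)) \<and>
    (\<forall>K\<subseteq>W. clique E K \<longrightarrow> (\<exists>t\<in>pverts T. K \<subseteq> X t)) \<and>
    (\<forall>u\<in>W. connected_on (parcs T) {t \<in> pverts T. u \<in> X t})"
  using assms(1,4)
proof (induction "card W" arbitrary: W)
  case 0
  then have "W = {}" by simp
  then show ?case
    \<comment> \<open>A tree has at least one node, so the empty graph receives one empty
      bag.\<close>
    by (intro exI[of _ "\<lparr> pverts = {0}, parcs = {} \<rparr>"] exI[of _ "\<lambda>_. {}"])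
      (auto simp: undirected_tree_singleton clique_def)
next
  case (Suc n)
  then have "W \<noteq> {}" by auto
  then obtain z where z: "z \<in> W" "simplicial E W z"
    using dirac_simplicial[OF Suc.prems(1) assms(2,3) Suc.prems(2)[rule_format]] by blast
  let ?W = "W - {z}"
  have "n = card ?W" using Suc.hyps(2) Suc.prems(1) z(1) by simp
  moreover have "\<forall>c. set c \<subseteq> ?W \<longrightarrow> \<not> hole E c" using Suc.prems(2) by blast
  moreover have "finite ?W" using Suc.prems(1) by simp
  ultimately obtain T :: "nat pair_pre_digraph" and X where T: "undirected_tree T"
    and X: "\<forall>t\<in>pverts T. X t \<subseteq> ?W \<and> clique E (X t)"
    and K: "\<forall>K\<subseteq>?W. clique E K \<longrightarrow> (\<exists>t\<in>pverts T. K \<subseteq> X t)"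
    and conn: "\<forall>u\<in>?W. connected_on (parcs T) {t \<in> pverts T. u \<in> X t}"
    using Suc.hyps(1)[of ?W] by (elim exE conjE meta_impE) assumption
  define N where "N = {x \<in> W. (z, x) \<in> E}"
  have N: "clique E N" "N \<subseteq> ?W"
    using z(2) assms(3) by (auto simp: simplicial_def N_def irrefl_def)
  then obtain t where t: "t \<in> pverts T" "N \<subseteq> X t" using K by blast
  have "finite (pverts T)"
    using T by (auto simp: undirected_tree_iff pair_graph_def pair_digraph_def
      pair_fin_digraph_def pair_fin_digraph_axioms_def)
  then obtain l where l: "l \<notin> pverts T" using ex_new_if_finite infinite_UNIV_nat by blast
  let ?T = "\<lparr> pverts = insert l (pverts T), parcs = parcs T \<union> {(l, t), (t, l)} \<rparr>"
  \<comment> \<open>The new leaf carries the closed neighbourhood of \<open>z\<close> and hangs on a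
    node whose bag contains all of \<open>N\<close>.\<close>
  let ?X = "X(l := insert z N)"
  have old: "?X s = X s" if "s \<in> pverts T" for s using that l by auto
  have "undirected_tree ?T" using T t(1) l by (rule undirected_tree_insert_leaf)
  moreover have "clique E (insert z N)"
    using N(1) assms(2) by (auto simp: clique_def N_def dest: symD)
  then have "\<forall>s\<in>pverts ?T. ?X s \<subseteq> W \<and> clique E (?X s)"
    using X old z(1) by (auto simp: N_def)
  moreover have "\<exists>s\<in>pverts ?T. A \<subseteq> ?X s" if A: "A \<subseteq> W" "clique E A" for A
  proof (cases "z \<in> A")
    case True
    \<comment> \<open>A clique through \<open>z\<close> fits into the new bag; any other clique is
      covered by the old tree.\<close>
    then have "A \<subseteq> insert z N" using A by (auto simp: clique_def N_def)
    then show ?thesis by auto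
  next
    case False
    then obtain s where "s \<in> pverts T" "A \<subseteq> X s" using A K by (metis subset_Diff_insert Diff_empty)
    then show ?thesis using old by auto
  qed
  moreover have "connected_on (parcs ?T) {s \<in> pverts ?T. u \<in> ?X s}" if "u \<in> W" for u
  proof (cases "u = z")
    case True
    then have "{s \<in> pverts ?T. u \<in> ?X s} = {l}" using X old by auto
    then show ?thesis by (simp add: connected_on_def)
  next
    case False
    let ?S = "{s \<in> pverts T. u \<in> X s}"
    have S: "connected_on (parcs T) ?S" using conn that False by simp
    show ?thesis
    proof (cases "u \<in> N")
      case True
      \<comment> \<open>The vertices of \<open>N\<close> gain the node \<open>l\<close>, attached to
        \<open>t\<close>, which already holds them.\<close>
      then have "{s \<in> pverts ?T. u \<in> ?X s} = insert l ?S" using l by auto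
      moreover have "connected_on (parcs ?T) (insert l ?S)"
        by (rule connected_on_insert_leaf[OF S]) (use t True in auto)
      ultimately show ?thesis by simp
    next
      case uN: False
      then have "{s \<in> pverts ?T. u \<in> ?X s} = ?S" using l False by auto
      moreover have "connected_on (parcs ?T) ?S"
        using S by (auto simp: connected_on_def intro: rtrancl_on_mono[of "parcs T"])
      ultimately show ?thesis by simp
    qed
  qed
  ultimately show ?case by blast
qed

subsection \<open>Tree-independence number\<close>

text \<open>Two distinct nonadjacent vertices of \<open>B\<close> form an independent set of size 2,
  and a clique contains none. Finiteness of \<open>B\<close> and the independent set
  \<open>{}\<close> make the \<open>Max\<close> well behaved.\<close>

lemma independence_number_le_1_iff:
  assumes "finite B" "irrefl (parcs G)" "sym (parcs G)"
  shows "independence_number (with_proj G \<restriction> B) \<le> 1 \<longleftrightarrow> clique (parcs G) B"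
proof -
  have ind: "independent_set (with_proj G \<restriction> B) S \<longleftrightarrow>
      S \<subseteq> B \<and> (\<forall>u\<in>S. \<forall>v\<in>S. (u, v) \<notin> parcs G)" for S
    by (auto simp: independent_set_def arcs_ends_conv induce_subgraph_def)
  have "finite {S. independent_set (with_proj G \<restriction> B) S}"
    by (rule finite_subset[of _ "Pow B"]) (auto simp: ind assms(1))
  moreover have "independent_set (with_proj G \<restriction> B) {}" by (simp add: ind)
  ultimately have "independence_number (with_proj G \<restriction> B) \<le> 1 \<longleftrightarrow>
      (\<forall>S. independent_set (with_proj G \<restriction> B) S \<longrightarrow> card S \<le> 1)"
    unfolding independence_number_def by (subst Max_le_iff) auto
  also have "\<dots> \<longleftrightarrow> clique (parcs G) B"
  proof
    assume small: "\<forall>S. independent_set (with_proj G \<restriction> B) S \<longrightarrow> card S \<le> 1"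
    show "clique (parcs G) B"
      unfolding clique_def
    proof (intro ballI impI, rule ccontr)
      fix x y assume xy: "x \<in> B" "y \<in> B" "x \<noteq> y" "(x, y) \<notin> parcs G"
      then have "independent_set (with_proj G \<restriction> B) {x, y}"
        using assms(2,3) by (auto simp: ind irrefl_def dest: symD)
      then show False using small xy(3) by fastforce
    qed
  next
    assume cl: "clique (parcs G) B"
    show "\<forall>S. independent_set (with_proj G \<restriction> B) S \<longrightarrow> card S \<le> 1"
    proof (intro allI impI)
      fix S assume S: "independent_set (with_proj G \<restriction> B) S"
      then have "finite S" using assms(1) by (auto simp: ind intro: finite_subset)
      then show "card S \<le> 1"
        using S cl unfolding ind clique_def One_nat_def
        by (subst card_le_Suc0_iff_eq) blast+
    qed
  qed
  finally show ?thesis .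
qed

lemma decomposition_independence_number_le_1_iff:
  assumes "pair_graph G" "tree_decomposition G T X"
  shows "decomposition_independence_number G T X \<le> 1 \<longleftrightarrow>
    (\<forall>t\<in>pverts T. clique (parcs G) (X t))"
proof -
  interpret G: pair_graph G by fact
  have T: "undirected_tree T" "\<And>t. t \<in> pverts T \<Longrightarrow> X t \<subseteq> pverts G"
    using assms(2) by (auto simp: tree_decomposition_def)
  interpret T: pair_graph T using T(1) by (simp add: undirected_tree_iff)
  have G: "sym (parcs G)" "irrefl (parcs G)"
    using G.pair_sym_arcs G.no_loops' by (auto simp: symmetric_def irrefl_def)
  have "pverts T \<noteq> {}" using T(1) by (auto simp: undirected_tree_iff connected_on_def)
  then have "decomposition_independence_number G T X \<le> 1 \<longleftrightarrow>
      (\<forall>t\<in>pverts T. independence_number (with_proj G \<restriction> X t) \<le> 1)"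
    unfolding decomposition_independence_number_def
    using T.pair_finite_verts by (subst Max_le_iff) auto
  also have "\<dots> \<longleftrightarrow> (\<forall>t\<in>pverts T. clique (parcs G) (X t))"
    using G finite_subset[OF T(2) G.pair_finite_verts]
    by (intro ball_cong refl independence_number_le_1_iff) auto
  finally show ?thesis .
qed

text \<open>Guarantees that the \<open>LEAST\<close> in \<open>tree_alpha\<close> ranges over a
  nonempty set and is therefore attained.\<close>

lemma tree_decomposition_trivial:
  assumes "pair_graph G"
  shows "tree_decomposition G \<lparr> pverts = {t}, parcs = {} \<rparr> (\<lambda>_. pverts G)"
proof -
  interpret pair_graph G by fact
  have "sym (parcs \<lparr> pverts = {t}, parcs = {} \<rparr>)" by (simp add: sym_def)
  then show ?thesis
    using in_arcsD1 in_arcsD2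
    by (auto simp: tree_decomposition_def undirected_tree_singleton connected_restrict_iff
      connected_on_def)
qed

lemma tree_alpha_le_iff:
  assumes "pair_graph G"
  shows "tree_alpha G \<le> k \<longleftrightarrow> (\<exists>(T :: nat pair_pre_digraph) X.
    tree_decomposition G T X \<and> decomposition_independence_number G T X \<le> k)"
    (is "_ \<longleftrightarrow> ?R")
proof
  assume le: "tree_alpha G \<le> k"
  have "\<exists>(T :: nat pair_pre_digraph) X.
      tree_decomposition G T X \<and> decomposition_independence_number G T X = tree_alpha G"
    unfolding tree_alpha_def 
    by (rule LeastI_ex, rule exI, rule exI, rule exI, rule conjI,
      rule tree_decomposition_trivial[OF assms, of 0], rule refl)
  then show ?R using le by metis
next
  assume ?R
  then obtain T :: "nat pair_pre_digraph" and X
    where TX: "tree_decomposition G T X" "decomposition_independence_number G T X \<le> k" by blast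
  have "tree_alpha G \<le> decomposition_independence_number G T X"
    unfolding tree_alpha_def by (rule Least_le, rule exI, rule exI, rule conjI, rule TX(1), rule refl)
  then show "tree_alpha G \<le> k" using TX(2) by simp
qed

theorem theorem3p3:
  fixes G :: "'a pair_pre_digraph"
  assumes "pair_graph G"
  shows "tree_alpha G \<le> 1 \<longleftrightarrow> chordal G"
proof
  interpret G: pair_graph G by fact
  assume "tree_alpha G \<le> 1"
  then obtain T :: "nat pair_pre_digraph" and X
    where TX: "tree_decomposition G T X" "decomposition_independence_number G T X \<le> 1"
    using tree_alpha_le_iff[OF assms] by blast
  then have cl: "\<And>t. t \<in> pverts T \<Longrightarrow> clique (parcs G) (X t)"
    using decomposition_independence_number_le_1_iff[OF assms] by blast
  have T: "undirected_tree T" using TX(1) by (simp add: tree_decomposition_def)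
  then interpret T: pair_graph T by (simp add: undirected_tree_iff)
  have symT: "sym (parcs T)" using T.pair_sym_arcs by (simp add: symmetric_def)
  show "chordal G"
    unfolding chordal_iff_no_hole[OF assms]
  proof (intro allI impI notI)
    fix c assume c: "set c \<subseteq> pverts G" "hole (parcs G) c"
    \<comment> \<open>Taking \<open>U\<close> to be the hole restricts the decomposition to it
      without altering the bags.\<close>
    have "\<exists>u\<in>set c. simplicial (parcs G) (set c) u"
    proof (rule clique_forest_simplicial[of "pverts T" "parcs T"])
      show "finite (pverts T)" by (rule T.pair_finite_verts)
      show "parcs T \<subseteq> pverts T \<times> pverts T" using T.in_arcsD1 T.in_arcsD2 by auto
      show "sym (parcs T)" by (rule symT)
      show "irrefl (parcs T)" using T.no_loops' by (auto simp: irrefl_def)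
      show "acyclic_graph (parcs T)" using T by (simp add: undirected_tree_iff)
      show "set c \<noteq> {}" using c(2) by (auto simp: hole_def)
      show "connected_on (parcs T) {t \<in> pverts T. u \<in> X t}" if "u \<in> set c" for u
        using that c(1) TX(1) by (auto simp: tree_decomposition_def connected_restrict_iff[OF symT])
      show "\<exists>t\<in>pverts T. u \<in> X t \<and> v \<in> X t" if "(u, v) \<in> parcs G" for u v
        using that TX(1) by (auto simp: tree_decomposition_def)
    qed (rule cl)
    then show False using not_simplicial_hole[OF c(2)] by blast
  qed
next
  interpret G: pair_graph G by fact
  have G: "sym (parcs G)" "irrefl (parcs G)"
    using G.pair_sym_arcs G.no_loops' by (auto simp: symmetric_def irrefl_def)
  assume "chordal G"
  then have "\<forall>c. set c \<subseteq> pverts G \<longrightarrow> \<not> hole (parcs G) c"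
    using chordal_iff_no_hole[OF assms] by blast
  from clique_tree_exists[OF G.pair_finite_verts G this]
  obtain T :: "nat pair_pre_digraph" and X where T: "undirected_tree T"
    and X: "\<forall>t\<in>pverts T. X t \<subseteq> pverts G \<and> clique (parcs G) (X t)"
    and K: "\<forall>K\<subseteq>pverts G. clique (parcs G) K \<longrightarrow> (\<exists>t\<in>pverts T. K \<subseteq> X t)"
    and conn: "\<forall>u\<in>pverts G. connected_on (parcs T) {t \<in> pverts T. u \<in> X t}"
    by (elim exE conjE) assumption
  have symT: "sym (parcs T)"
    using T pair_graph.axioms(2) pair_pseudo_graph.axioms(2) pair_sym_digraph.pair_sym_arcs
    by (fastforce simp: undirected_tree_iff symmetric_def)
  \<comment> \<open>Single vertices and edges are cliques, so the clique clause \<open>K\<close>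
    yields both covering conditions.\<close>
  have "\<exists>t\<in>pverts T. u \<in> X t" if "u \<in> pverts G" for u
    using K[rule_format, of "{u}"] that by (auto simp: clique_def)
  moreover have "\<exists>t\<in>pverts T. u \<in> X t \<and> v \<in> X t" if "(u, v) \<in> parcs G" for u v
    using K[rule_format, of "{u, v}"] that G(1) G.in_arcsD1 G.in_arcsD2 by (auto simp: clique_def dest: symD)
  ultimately have "tree_decomposition G T X"
    using T X conn by (auto simp: tree_decomposition_def connected_restrict_iff[OF symT])
  then show "tree_alpha G \<le> 1"
    using X decomposition_independence_number_le_1_iff[OF assms] tree_alpha_le_iff[OF assms] by blast
qed

end
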